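(* There is an algorithm which, given a finite lattice-oriented signature $\mathcal{L}$ and a finite $\mathcal{L}$-lattice $L$ (by the finite tables of its operations), decides whether $L$ has the interpolation property.
   Context: A lattice-oriented signature $\mathcal{L}$ is a finite set of connectives. Each connective $c$ has an arity $n_c\in\mathbb{N}$ and a polarity $p_c:\{1,\dots,n_c\}\to\{-,+\}$. The signature contains binary connectives $\lor,\land,\to$ with $p_\lor(1)=p_\lor(2)=p_\land(1)=p_\land(2)=+$, $p_\to(1)=-$ and $p_\to(2)=+$; nullary connectives are truth constants. A finite $\mathcal{L}$-lattice is a finite set $L$ together with an $n_c$-ary operation $c^L$ on $L$ for each connective $c$, such that: - $(L,\lor^L,\land^L)$ is a lattice, with order $x\le y$ iff $x\land y=x$; its top element is denoted $1$; - $c^L$ is monotone in every argument $i$ with $p_c(i)=+$ and antitone in every argument $i$ with $p_c(i)=-$; - for all $a,b\in L$: $1\le a\to^L b$ iff $a\le b$. Formulas (words) are built from propositional variables using the connectives. A valuation assigns elements of $L$ to the variables and extends to all formulas via the operations $c^L$. For formulas $a,b$, "$a\le b$ is valid" means that the value of $a$ is $\le$ the value of $b$ under every valuation. For a valid $a\le b$, the variables occurring only in $a$ are the left variables, those occurring only in $b$ are the right variables, and those occurring in both are the intersection variables. $L$ has the interpolation property iff for all formulas $a,b$ with $a\le b$ valid there is a formula $i$ whose variables are all intersection variables of $a,b$ such that $a\le i$ and $i\le b$ are valid. If there are no intersection variables, $i$ must be a closed formula. *)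

theory Defs
  imports Main "HOL-Library.Nat_Bijection"
begin

datatype recf = Zf | Sf | Proj nat | Comp recf "recf list" | Prec recf recf | Mn recf

inductive rec_eval :: "recf \<Rightarrow> nat list \<Rightarrow> nat \<Rightarrow> bool" where
  zero: "rec_eval Zf xs 0"
| succ: "rec_eval Sf (x # xs) (Suc x)"
| proj: "i < length xs \<Longrightarrow> rec_eval (Proj i) xs (xs ! i)"
| comp: "list_all2 (\<lambda>g y. rec_eval g xs y) gs ys \<Longrightarrow> rec_eval f ys z
         \<Longrightarrow> rec_eval (Comp f gs) xs z"
| prec0: "rec_eval f xs y \<Longrightarrow> rec_eval (Prec f g) (0 # xs) y"
| precS: "rec_eval (Prec f g) (n # xs) y \<Longrightarrow> rec_eval g (n # y # xs) z
          \<Longrightarrow> rec_eval (Prec f g) (Suc n # xs) z"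
| mn: "rec_eval f (n # xs) 0 \<Longrightarrow> (\<forall>m<n. \<exists>y. rec_eval f (m # xs) (Suc y))
       \<Longrightarrow> rec_eval (Mn f) xs n"

text \<open>A signature is a finite list of connectives; connective number c has arity
  fst (S!c) and polarity list snd (S!c) (True = +, False = -), the polarity of
  argument i (1-based) being snd (S!c) ! (i-1).  Connectives 0, 1, 2 are the
  join, meet and implication.\<close>

type_synonym signature = "(nat \<times> bool list) list"

definition wf_sig :: "signature \<Rightarrow> bool" where
  "wf_sig S \<longleftrightarrow> 3 \<le> length S
     \<and> S ! 0 = (2, [True, True]) \<and> S ! 1 = (2, [True, True]) \<and> S ! 2 = (2, [False, True])
     \<and> (\<forall>c \<in> set S. length (snd c) = fst c)"

text \<open>A finite L-lattice: carrier {0..<n}, operation of connective c given by ops c.\<close>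

definition ljoin :: "(nat \<Rightarrow> nat list \<Rightarrow> nat) \<Rightarrow> nat \<Rightarrow> nat \<Rightarrow> nat" where
  "ljoin ops x y = ops 0 [x, y]"
definition lmeet :: "(nat \<Rightarrow> nat list \<Rightarrow> nat) \<Rightarrow> nat \<Rightarrow> nat \<Rightarrow> nat" where
  "lmeet ops x y = ops 1 [x, y]"
definition limp :: "(nat \<Rightarrow> nat list \<Rightarrow> nat) \<Rightarrow> nat \<Rightarrow> nat \<Rightarrow> nat" where
  "limp ops x y = ops 2 [x, y]"
definition lle :: "(nat \<Rightarrow> nat list \<Rightarrow> nat) \<Rightarrow> nat \<Rightarrow> nat \<Rightarrow> bool" where
  "lle ops x y \<longleftrightarrow> lmeet ops x y = x"

definition is_L_lattice :: "signature \<Rightarrow> nat \<Rightarrow> (nat \<Rightarrow> nat list \<Rightarrow> nat) \<Rightarrow> bool" where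
  "is_L_lattice S n ops \<longleftrightarrow> 0 < n
   \<comment> \<open>closure of the carrier under all operations\<close>
   \<and> (\<forall>c < length S. \<forall>xs. length xs = fst (S ! c) \<and> set xs \<subseteq> {..<n} \<longrightarrow> ops c xs < n)
   \<comment> \<open>lattice axioms for join and meet\<close>
   \<and> (\<forall>x<n. \<forall>y<n. ljoin ops x y = ljoin ops y x \<and> lmeet ops x y = lmeet ops y x)
   \<and> (\<forall>x<n. \<forall>y<n. \<forall>z<n. ljoin ops (ljoin ops x y) z = ljoin ops x (ljoin ops y z)
                      \<and> lmeet ops (lmeet ops x y) z = lmeet ops x (lmeet ops y z))
   \<and> (\<forall>x<n. \<forall>y<n. ljoin ops x (lmeet ops x y) = x \<and> lmeet ops x (ljoin ops x y) = x)
   \<comment> \<open>monotone in positive, antitone in negative arguments\<close>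
   \<and> (\<forall>c < length S. \<forall>xs ys. length xs = fst (S ! c) \<and> length ys = fst (S ! c)
        \<and> set xs \<subseteq> {..<n} \<and> set ys \<subseteq> {..<n} \<longrightarrow>
        (\<forall>i < fst (S ! c). \<forall>x<n. \<forall>y<n.
           lle ops x y \<longrightarrow>
           (if snd (S ! c) ! i then lle ops (ops c (xs[i := x])) (ops c (xs[i := y]))
            else lle ops (ops c (xs[i := y])) (ops c (xs[i := x])))))
   \<comment> \<open>residuation-type condition: 1 \<le> a \<rightarrow> b iff a \<le> b, 1 the top element\<close>
   \<and> (\<forall>t<n. (\<forall>x<n. lle ops x t) \<longrightarrow>
        (\<forall>a<n. \<forall>b<n. lle ops t (limp ops a b) \<longleftrightarrow> lle ops a b))"

datatype form = Var nat | Op nat "form list"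

fun wf_form :: "signature \<Rightarrow> form \<Rightarrow> bool" where
  "wf_form S (Var x) = True"
| "wf_form S (Op c as) = (c < length S \<and> length as = fst (S ! c) \<and> (\<forall>a \<in> set as. wf_form S a))"

fun vars :: "form \<Rightarrow> nat set" where
  "vars (Var x) = {x}"
| "vars (Op c as) = (\<Union>a \<in> set as. vars a)"

fun feval :: "(nat \<Rightarrow> nat list \<Rightarrow> nat) \<Rightarrow> (nat \<Rightarrow> nat) \<Rightarrow> form \<Rightarrow> nat" where
  "feval ops v (Var x) = v x"
| "feval ops v (Op c as) = ops c (map (feval ops v) as)"

definition valid_le :: "nat \<Rightarrow> (nat \<Rightarrow> nat list \<Rightarrow> nat) \<Rightarrow> form \<Rightarrow> form \<Rightarrow> bool" where
  "valid_le n ops a b \<longleftrightarrow> (\<forall>v. (\<forall>x. v x < n) \<longrightarrow> lle ops (feval ops v a) (feval ops v b))"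

definition has_IP :: "signature \<Rightarrow> nat \<Rightarrow> (nat \<Rightarrow> nat list \<Rightarrow> nat) \<Rightarrow> bool" where
  "has_IP S n ops \<longleftrightarrow>
     (\<forall>a b. wf_form S a \<and> wf_form S b \<and> valid_le n ops a b \<longrightarrow>
        (\<exists>i. wf_form S i \<and> vars i \<subseteq> vars a \<inter> vars b
             \<and> valid_le n ops a i \<and> valid_le n ops i b))"

fun tuples :: "nat \<Rightarrow> nat \<Rightarrow> nat list list" where
  "tuples n 0 = [[]]"
| "tuples n (Suc k) = concat (map (\<lambda>x. map (\<lambda>t. x # t) (tuples n k)) [0..<n])"

definition encode_conn :: "nat \<times> bool list \<Rightarrow> nat" where
  "encode_conn cp = prod_encode (fst cp, list_encode (map of_bool (snd cp)))"

definition encode_input :: "signature \<Rightarrow> nat \<Rightarrow> (nat \<Rightarrow> nat list \<Rightarrow> nat) \<Rightarrow> nat" where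
  "encode_input S n ops = list_encode
     [list_encode (map encode_conn S), n,
      list_encode (map (\<lambda>c. list_encode (map (ops c) (tuples n (fst (S ! c))))) [0..<length S])]"

end

theory Submission
  imports Defs
begin

text \<open>For a valid a \<le> b, an interpolant is the join over valuations v of the meets over
  valuations v' of formulas i(v, v') satisfying only a(v) \<le> i(v) and i(v') \<le> b(v'). For fixed v
  and v', a left variable matters only through its value at v, a right variable through its value
  at v' and an intersection variable through the pair of both, so identifying variables leaves
  n left, n right and n^2 intersection variables. Over these there are finitely many
  term functions, and a table is a term function iff it lies in every set of tables that contains
  the projections and is closed under the operations. Coding tables by the digits of numbers, all
  quantifiers become bounded. A nullary connective must exist because of
  (x \<rightarrow> x) \<le> (y \<rightarrow> y); it then stands in for intersection variables that do not occur.\<close>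

section \<open>Closure properties of the recursive functions\<close>

text \<open>Functions of an environment e, of which only finitely many entries are passed to the
  program; variables bound by a quantifier or a recursion are pushed in front of e.\<close>

definition computable :: "((nat \<Rightarrow> nat) \<Rightarrow> nat) \<Rightarrow> bool" where
  "computable f \<longleftrightarrow> (\<exists>k r. \<forall>e. rec_eval r (map e [0..<k]) (f e))"

abbreviation decidable :: "((nat \<Rightarrow> nat) \<Rightarrow> bool) \<Rightarrow> bool" where
  "decidable P \<equiv> computable (\<lambda>e. of_bool (P e))"

lemma rec_eval_Proj_map:
  "i < k \<Longrightarrow> rec_eval (Proj i) (map e [0..<k]) (e i)"
  using rec_eval.proj[of i "map e [0..<k]"] by simp

text \<open>Projecting onto the first \<open>k0\<close> entries adapts a program to any longer
  prefix of the environment, so several programs can be brought to a common arity before they are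
  composed.\<close>

lemma computable_large_arity:
  assumes "computable f"
  shows "\<exists>k0. \<forall>k\<ge>k0. \<exists>r. \<forall>e. rec_eval r (map e [0..<k]) (f e)"
proof -
  obtain k0 r where r: "\<And>e. rec_eval r (map e [0..<k0]) (f e)"
    using assms unfolding computable_def by blast
  have "rec_eval (Comp r (map Proj [0..<k0])) (map e [0..<k]) (f e)" if "k0 \<le> k" for k e
    using that
    by (intro rec_eval.comp[OF _ r]) (auto simp: list_all2_conv_all_nth intro!: rec_eval_Proj_map)
  then show ?thesis by blast
qed

text \<open>Although infinitely many \<open>g i\<close> are substituted, \<open>h\<close> is
  computed from its first \<open>k\<close> entries, so only finitely many programs are composed; the
  sum of their arity bounds is a common arity for them.\<close>

lemma computable_substitution:
  assumes "computable h" "\<And>i. computable (g i)"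
  shows "computable (\<lambda>e. h (\<lambda>i. g i e))"
proof -
  obtain k r where r: "\<And>e. rec_eval r (map e [0..<k]) (h e)"
    using assms(1) unfolding computable_def by blast
  obtain a where a: "\<And>i m. a i \<le> m \<Longrightarrow> \<exists>r. \<forall>e. rec_eval r (map e [0..<m]) (g i e)"
    using computable_large_arity[OF assms(2)] by metis
  define m where "m = (\<Sum>i<k. a i)"
  have "a i \<le> m" if "i < k" for i
    unfolding m_def using that by (intro member_le_sum) auto
  with a have "\<forall>i. \<exists>q. i < k \<longrightarrow> (\<forall>e. rec_eval q (map e [0..<m]) (g i e))" by blast
  then obtain q where q: "\<And>i e. i < k \<Longrightarrow> rec_eval (q i) (map e [0..<m]) (g i e)"
    by metis
  have "rec_eval (Comp r (map q [0..<k])) (map e [0..<m]) (h (\<lambda>i. g i e))" for e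
    by (intro rec_eval.comp[OF _ r]) (auto simp: list_all2_conv_all_nth intro!: q)
  then show ?thesis unfolding computable_def by blast
qed

lemma computable_var: "computable (\<lambda>e. e i)"
  unfolding computable_def by (intro exI[of _ "Suc i"] exI[of _ "Proj i"] allI rec_eval_Proj_map) simp

lemma computable_reindex: "computable f \<Longrightarrow> computable (\<lambda>e. f (\<lambda>i. e (k i)))"
  by (rule computable_substitution[where g = "\<lambda>i e. e (k i)"]) (auto intro: computable_var)

text \<open>Reducing to a plain variable as argument lets the definition of \<open>F\<close> be
  unfolded while \<open>f\<close> stays outside the bound variables that appear, where its
  environment would have to be shifted.\<close>

lemma computable_comp1:
  assumes "computable (\<lambda>e. F (e 0))" "computable f"
  shows "computable (\<lambda>e. F (f e))"
  using computable_substitution[OF assms(1), of "\<lambda>_. f"] assms(2) by simp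

lemma computable_comp2:
  assumes "computable (\<lambda>e. F (e 0) (e 1))" "computable f" "computable g"
  shows "computable (\<lambda>e. F (f e) (g e))"
  using computable_substitution[OF assms(1), of "\<lambda>i. if i = 0 then f else g"] assms(2,3) by simp

lemma computable_zero: "computable (\<lambda>e. 0)"
  unfolding computable_def using rec_eval.zero by blast

lemma computable_Suc:
  assumes "computable f" shows "computable (\<lambda>e. Suc (f e))"
proof (rule computable_comp1[OF _ assms])
  have "rec_eval Sf (map e [0..<1]) (Suc (e 0))" for e
    using rec_eval.succ by simp
  then show "computable (\<lambda>e. Suc (e 0))" unfolding computable_def by blast
qed

lemma computable_const: "computable (\<lambda>e. c)"
  by (induction c) (auto intro: computable_zero computable_Suc)

lemma map_case_nat_upt: "map (case_nat a e) [0..<Suc k] = a # map e [0..<k]"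
  by (simp add: upt_conv_Cons map_Suc_upt[symmetric] comp_def del: upt_Suc)

text \<open>Entries 0 and 1 of the shifted environment are the counter and the previous value, in
  the order in which \<open>Prec\<close> hands them to its step program.\<close>

lemma computable_rec_nat:
  assumes "computable base" "computable (\<lambda>e. step (e 0) (e (Suc 0)) (\<lambda>i. e (Suc (Suc i))))"
    and "computable bound"
  shows "computable (\<lambda>e. rec_nat (base e) (\<lambda>n y. step n y e) (bound e))"
proof -
  let ?R = "\<lambda>e n. rec_nat (base e) (\<lambda>n y. step n y e) n"
  obtain k1 where k1: "\<forall>k\<ge>k1. \<exists>r. \<forall>e. rec_eval r (map e [0..<k]) (base e)"
    using computable_large_arity[OF assms(1)] by blast
  obtain k2 where k2: "\<forall>k\<ge>k2. \<exists>r. \<forall>e. rec_eval r (map e [0..<k]) (step (e 0) (e (Suc 0)) (\<lambda>i. e (Suc (Suc i))))"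
    using computable_large_arity[OF assms(2)] by blast
  obtain k3 where k3: "\<forall>k\<ge>k3. \<exists>r. \<forall>e. rec_eval r (map e [0..<k]) (bound e)"
    using computable_large_arity[OF assms(3)] by blast
  define k where "k = k1 + k2 + k3"
  obtain p where p: "\<And>e. rec_eval p (map e [0..<k]) (base e)"
    using k1 k_def by force
  obtain q where q: "\<And>e. rec_eval q (map e [0..<Suc (Suc k)]) (step (e 0) (e (Suc 0)) (\<lambda>i. e (Suc (Suc i))))"
    using k2[rule_format, of "Suc (Suc k)"] k_def by (auto simp del: upt_Suc)
  obtain r where r: "\<And>e. rec_eval r (map e [0..<k]) (bound e)"
    using k3 k_def by force
  have q': "rec_eval q (n # y # map e [0..<k]) (step n y e)" for n y e
    using q[of "case_nat n (case_nat y e)"] by (simp add: map_case_nat_upt del: upt_Suc)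
  have rec: "rec_eval (Prec p q) (n # map e [0..<k]) (?R e n)" for n e
    by (induction n) (auto intro: rec_eval.prec0 p rec_eval.precS q')
  have "list_all2 (\<lambda>g. rec_eval g (map e [0..<k])) (map Proj [0..<k]) (map e [0..<k])" for e
    by (auto simp: list_all2_conv_all_nth intro!: rec_eval_Proj_map)
  then have "rec_eval (Comp (Prec p q) (r # map Proj [0..<k])) (map e [0..<k]) (?R e (bound e))" for e
    by (intro rec_eval.comp[OF _ rec]) (simp add: r)
  then show ?thesis unfolding computable_def by blast
qed

section \<open>Arithmetic, Boolean operations and bounded quantifiers\<close>

lemma computable_add:
  assumes "computable f" "computable g"
  shows "computable (\<lambda>e. f e + g e)"
proof -
  have "rec_nat a (\<lambda>_ y. Suc y) b = a + b" for a b by (induction b) auto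
  moreover have "computable (\<lambda>e. rec_nat (f e) (\<lambda>_ y. Suc y) (g e))"
    by (intro computable_rec_nat computable_Suc computable_var assms)
  ultimately show ?thesis by simp
qed

lemma computable_mult:
  assumes "computable f" "computable g"
  shows "computable (\<lambda>e. f e * g e)"
proof -
  have "rec_nat 0 (\<lambda>_ y. y + a) b = a * b" for a b :: nat by (induction b) auto
  moreover have "computable (\<lambda>e. rec_nat 0 (\<lambda>_ y. y + f e) (g e))"
    by (intro computable_rec_nat computable_add computable_const computable_var computable_reindex[OF assms(1)] assms)
  ultimately show ?thesis by simp
qed

lemma computable_power:
  assumes "computable f" "computable g"
  shows "computable (\<lambda>e. f e ^ g e)"
proof -
  have "rec_nat (Suc 0) (\<lambda>_ y. y * a) b = a ^ b" for a b :: nat by (induction b) auto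
  moreover have "computable (\<lambda>e. rec_nat (Suc 0) (\<lambda>_ y. y * f e) (g e))"
    by (intro computable_rec_nat computable_mult computable_const computable_var computable_reindex[OF assms(1)] assms)
  ultimately show ?thesis by simp
qed

lemma computable_diff:
  assumes "computable f" "computable g"
  shows "computable (\<lambda>e. f e - g e)"
proof -
  have pred: "computable (\<lambda>e. h e - Suc 0)" if "computable h" for h
  proof -
    \<comment> \<open>The step discards the previous value and returns the counter, which in the
      last round is the predecessor of the bound.\<close>
    have "rec_nat 0 (\<lambda>n y. n) b = b - Suc 0" for b :: nat by (induction b) auto
    moreover have "computable (\<lambda>e. rec_nat 0 (\<lambda>n y. n) (h e))"
      by (intro computable_rec_nat computable_const computable_var that)
    ultimately show ?thesis by simp
  qed
  have "rec_nat a (\<lambda>_ y. y - Suc 0) b = a - b" for a b :: nat by (induction b) auto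
  moreover have "computable (\<lambda>e. rec_nat (f e) (\<lambda>_ y. y - Suc 0) (g e))"
    by (intro computable_rec_nat pred computable_var assms)
  ultimately show ?thesis by simp
qed

lemma computable_sum:
  assumes "computable (\<lambda>e. f (e 0) (\<lambda>i. e (Suc i)))" "computable b"
  shows "computable (\<lambda>e. \<Sum>y<b e. f y e)"
proof -
  have "rec_nat 0 (\<lambda>n y. y + f n e) m = (\<Sum>y<m. f y e)" for m e by (induction m) auto
  \<comment> \<open>Entry 1 of the step's environment holds the partial sum, so the summand must
    skip it and read its parameters from entry 2 on.\<close>
  moreover have "computable (\<lambda>e. f (e 0) (\<lambda>i. e (Suc (Suc i))))"
    using computable_substitution[OF assms(1), of "\<lambda>i e. e (if i = 0 then 0 else Suc i)"]
    by (simp add: computable_var)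
  then have "computable (\<lambda>e. rec_nat 0 (\<lambda>n y. y + f n e) (b e))"
    by (intro computable_rec_nat computable_add computable_const computable_var assms)
  ultimately show ?thesis by simp
qed

lemma decidable_not:
  assumes "decidable P" shows "decidable (\<lambda>e. \<not> P e)"
proof -
  have "of_bool (\<not> P e) = 1 - (of_bool (P e) :: nat)" for e by simp
  then show ?thesis by (simp only:) (intro computable_diff computable_const assms)
qed

lemma decidable_conj: "decidable P \<Longrightarrow> decidable Q \<Longrightarrow> decidable (\<lambda>e. P e \<and> Q e)"
  unfolding of_bool_conj by (intro computable_mult)

lemma decidable_disj: "decidable P \<Longrightarrow> decidable Q \<Longrightarrow> decidable (\<lambda>e. P e \<or> Q e)"
  using decidable_not[of "\<lambda>e. \<not> P e \<and> \<not> Q e"] by (simp add: decidable_not decidable_conj)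

lemma decidable_imp: "decidable P \<Longrightarrow> decidable Q \<Longrightarrow> decidable (\<lambda>e. P e \<longrightarrow> Q e)"
  unfolding imp_conv_disj by (intro decidable_disj decidable_not)

lemma decidable_less:
  assumes "computable f" "computable g"
  shows "decidable (\<lambda>e. f e < g e)"
proof -
  have "of_bool (f e < g e) = 1 - (1 - (g e - f e))" for e by auto
  then show ?thesis using assms by (auto intro!: computable_diff computable_const)
qed

lemma decidable_le:
  "computable f \<Longrightarrow> computable g \<Longrightarrow> decidable (\<lambda>e. f e \<le> g e)"
  unfolding linorder_not_less[symmetric] by (intro decidable_not decidable_less)

lemma decidable_eq:
  "computable f \<Longrightarrow> computable g \<Longrightarrow> decidable (\<lambda>e. f e = g e)"
  unfolding order_eq_iff by (intro decidable_conj decidable_le)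

text \<open>The sum of the indicators over the search range is positive exactly when there is a
  witness.\<close>

lemma decidable_ex:
  assumes "decidable (\<lambda>e. P (e 0) (\<lambda>i. e (Suc i)))" "computable b"
  shows "decidable (\<lambda>e. \<exists>y<b e. P y e)"
proof -
  have "(\<exists>y<b e. P y e) \<longleftrightarrow> 0 < (\<Sum>y<b e. of_bool (P y e) :: nat)" for e
    by (auto simp: zero_less_iff_neq_zero)
  then show ?thesis using assms
    by (simp only:) (intro decidable_less computable_const computable_sum)
qed

lemma decidable_all:
  assumes "decidable (\<lambda>e. P (e 0) (\<lambda>i. e (Suc i)))" "computable b"
  shows "decidable (\<lambda>e. \<forall>y<b e. P y e)"
  using decidable_not[OF decidable_ex[OF decidable_not[OF assms(1)] assms(2)]] by simp

lemma computable_if: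
  assumes "decidable P" "computable f" "computable g"
  shows "computable (\<lambda>e. if P e then f e else g e)"
proof -
  have "(if P e then f e else g e) = of_bool (P e) * f e + of_bool (\<not> P e) * g e" for e
    by simp
  then show ?thesis
    by (simp only:) (intro computable_add computable_mult decidable_not assms)
qed

lemma computable_div:
  assumes "computable f" "computable g"
  shows "computable (\<lambda>e. f e div g e)"
proof -
  \<comment> \<open>The quotient counts the positive multiples of \<open>b\<close> up to
    \<open>a\<close>. For \<open>b = 0\<close> the sum would be \<open>a\<close>, hence the separate
    case.\<close>
  have eq: "a div b = (if b = 0 then 0 else \<Sum>q<a. of_bool (Suc q * b \<le> a))" for a b :: nat
  proof (cases "b = 0")
    case False
    then have "{q. q < a \<and> Suc q * b \<le> a} = {..<a div b}"
      using div_le_dividend[of a b]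
      by (auto simp: less_eq_div_iff_mult_less_eq[symmetric] Suc_le_eq simp del: mult_Suc div_le_dividend)
    then have "{..<a} \<inter> {q. Suc q * b \<le> a} = {..<a div b}" by auto
    then show ?thesis using False by (simp add: sum_of_bool_eq del: mult_Suc)
  qed simp
  show ?thesis
    by (rule computable_comp2[OF _ assms], subst eq)
      (intro computable_if decidable_eq decidable_le computable_sum computable_mult
        computable_Suc computable_var computable_const)
qed

lemma computable_mod:
  "computable f \<Longrightarrow> computable g \<Longrightarrow> computable (\<lambda>e. f e mod g e)"
  unfolding minus_div_mult_eq_mod[symmetric]
  by (intro computable_diff computable_mult computable_div)

lemmas computable_intros = computable_var computable_const
  computable_Suc computable_add computable_mult computable_power computable_diff computable_sum
  computable_if computable_div computable_mod
  decidable_not decidable_conj decidable_disj decidable_imp decidable_less decidable_le decidable_eq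
  decidable_ex decidable_all

section \<open>Encoded pairs and lists\<close>

definition efst :: "nat \<Rightarrow> nat" where "efst m = fst (prod_decode m)"
definition esnd :: "nat \<Rightarrow> nat" where "esnd m = snd (prod_decode m)"

lemma prod_encode_ge: "a \<le> prod_encode (a, b)" "b \<le> prod_encode (a, b)"
  using le_prod_encode_1 le_prod_encode_2 by auto

text \<open>The pairing is Cantor's, the triangle number of \<open>a + b\<close> plus
  \<open>a\<close>, and neither component exceeds the code. Decoding is thus a bounded search, and
  the sum has at most one nonzero term.\<close>

lemma efst_eq: "efst m = (\<Sum>a<Suc m. a * of_bool (\<exists>b<Suc m. (a + b) * Suc (a + b) div 2 + a = m))"
proof -
  obtain x y where xy: "m = prod_encode (x, y)"
    by (metis surj_pair prod_decode_inverse)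
  have "(\<exists>b<Suc m. (a + b) * Suc (a + b) div 2 + a = m) \<longleftrightarrow> a = x" for a
  proof -
    have "(a + b) * Suc (a + b) div 2 + a = m \<longleftrightarrow> a = x \<and> b = y" for b
      using prod_encode_eq[of "(a, b)" "(x, y)"] by (simp add: xy prod_encode_def triangle_def)
    then show ?thesis using prod_encode_ge(2)[where a = x and b = y] xy by auto
  qed
  moreover have "x < Suc m" using prod_encode_ge(1)[where a = x and b = y] xy by simp
  ultimately show ?thesis
    by (simp add: efst_def xy of_bool_def if_distrib sum.delta' cong: if_cong del: sum.lessThan_Suc)
qed

lemma esnd_eq: "esnd m = (\<Sum>b<Suc m. b * of_bool (\<exists>a<Suc m. (a + b) * Suc (a + b) div 2 + a = m))"
proof -
  obtain x y where xy: "m = prod_encode (x, y)"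
    by (metis surj_pair prod_decode_inverse)
  have "(\<exists>a<Suc m. (a + b) * Suc (a + b) div 2 + a = m) \<longleftrightarrow> b = y" for b
  proof -
    have "(a + b) * Suc (a + b) div 2 + a = m \<longleftrightarrow> a = x \<and> b = y" for a
      using prod_encode_eq[of "(a, b)" "(x, y)"] by (simp add: xy prod_encode_def triangle_def)
    then show ?thesis using prod_encode_ge(1)[where a = x and b = y] xy by auto
  qed
  moreover have "y < Suc m" using prod_encode_ge(2)[where a = x and b = y] xy by simp
  ultimately show ?thesis
    by (simp add: esnd_def xy of_bool_def if_distrib sum.delta' cong: if_cong del: sum.lessThan_Suc)
qed

lemma computable_efst: "computable f \<Longrightarrow> computable (\<lambda>e. efst (f e))"
  by (rule computable_comp1[where F = efst], unfold efst_eq) (intro computable_intros | assumption)+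

lemma computable_esnd: "computable f \<Longrightarrow> computable (\<lambda>e. esnd (f e))"
  by (rule computable_comp1[where F = esnd], unfold esnd_eq) (intro computable_intros | assumption)+

text \<open>\<open>list_encode\<close> sends the empty list to 0 and a nonempty list to the
  successor of a pair, so 1 is subtracted before decoding. As 0 decodes to the pair of zeros,
  dropping past the end stays at the empty list.\<close>

definition edrop :: "nat \<Rightarrow> nat \<Rightarrow> nat" where
  "edrop m i = rec_nat m (\<lambda>_ y. esnd (y - 1)) i"
definition enth :: "nat \<Rightarrow> nat \<Rightarrow> nat" where
  "enth m i = efst (edrop m i - 1)"
text \<open>Exactly the suffixes before the end have nonzero codes, and a code is at least the
  length of its list, so \<open>m\<close> suffices as a bound.\<close>

definition elen :: "nat \<Rightarrow> nat" where
  "elen m = (\<Sum>i<m. of_bool (edrop m i \<noteq> 0))"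

lemma edrop_list_encode: "edrop (list_encode xs) i = list_encode (drop i xs)"
proof (induction i)
  case (Suc i)
  have "prod_decode 0 = (0, 0)"
    using prod_encode_inverse[of "(0, 0)"] by (simp add: prod_encode_def)
  then have "esnd (list_encode ys - 1) = list_encode (tl ys)" for ys
    by (cases ys) (simp_all add: esnd_def)
  then show ?case using Suc by (simp add: edrop_def drop_Suc tl_drop)
qed (simp add: edrop_def)

lemma enth_list_encode: "i < length xs \<Longrightarrow> enth (list_encode xs) i = xs ! i"
  by (simp add: enth_def edrop_list_encode Cons_nth_drop_Suc[symmetric] efst_def)

lemma length_le_list_encode: "length xs \<le> list_encode xs"
proof (induction xs)
  case (Cons x xs)
  then show ?case using prod_encode_ge(2)[where a = x and b = "list_encode xs"] by simp
qed simp

lemma elen_list_encode: "elen (list_encode xs) = length xs"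
proof -
  have "list_encode ys = 0 \<longleftrightarrow> ys = []" for ys by (cases ys) auto
  then have "edrop (list_encode xs) i \<noteq> 0 \<longleftrightarrow> i < length xs" for i
    by (simp only: edrop_list_encode) (simp add: not_le)
  then have "elen (list_encode xs) = card ({..<list_encode xs} \<inter> {..<length xs})"
    by (simp add: elen_def sum_of_bool_eq lessThan_def)
  also have "{..<list_encode xs} \<inter> {..<length xs} = {..<length xs}"
    using length_le_list_encode[of xs] by (intro Int_absorb1) simp
  finally show ?thesis by simp
qed

lemma computable_edrop: "computable f \<Longrightarrow> computable g \<Longrightarrow> computable (\<lambda>e. edrop (f e) (g e))"
  by (rule computable_comp2[where F = edrop], unfold edrop_def)
    (intro computable_rec_nat computable_esnd computable_intros | assumption)+

lemma computable_enth: "computable f \<Longrightarrow> computable g \<Longrightarrow> computable (\<lambda>e. enth (f e) (g e))"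
  unfolding enth_def by (intro computable_efst computable_edrop computable_intros)

lemma computable_elen: "computable f \<Longrightarrow> computable (\<lambda>e. elen (f e))"
  by (rule computable_comp1[where F = elen], unfold elen_def)
    (intro computable_edrop computable_intros | assumption)+

section \<open>Reduction to boundedly many variables\<close>

fun subst :: "(nat \<Rightarrow> form) \<Rightarrow> form \<Rightarrow> form" where
  "subst s (Var x) = s x"
| "subst s (Op c as) = Op c (map (subst s) as)"

lemma feval_subst: "feval ops v (subst s a) = feval ops (\<lambda>x. feval ops v (s x)) a"
  by (induction a) (auto intro!: arg_cong[of _ _ "ops _"])

lemma wf_subst: "wf_form S a \<Longrightarrow> (\<And>x. wf_form S (s x)) \<Longrightarrow> wf_form S (subst s a)"
  by (induction a) auto

lemma vars_subst: "vars (subst s a) = (\<Union>x\<in>vars a. vars (s x))"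
  by (induction a) auto

lemma finite_vars: "finite (vars a)"
  by (induction a) auto

lemma feval_cong: "(\<And>x. x \<in> vars a \<Longrightarrow> v x = v' x) \<Longrightarrow> feval ops v a = feval ops v' a"
proof (induction a)
  case (Op c as)
  then have "map (feval ops v) as = map (feval ops v') as" by fastforce
  then show ?case by (simp only: feval.simps)
qed simp

text \<open>Without variables, the descent into first arguments can end only in a connective applied
  to the empty list.\<close>

lemma closed_form_imp_nullary:
  "wf_form S i \<Longrightarrow> vars i = {} \<Longrightarrow> \<exists>c<length S. fst (S ! c) = 0"
proof (induction i)
  case (Op c as)
  then show ?case by (cases as) auto
qed simp

text \<open>Variables below n^2 are the intersection variables, the next n the left ones, the
  next n the right ones.\<close>

definition IP_restricted :: "signature \<Rightarrow> nat \<Rightarrow> (nat \<Rightarrow> nat list \<Rightarrow> nat) \<Rightarrow> bool" where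
  "IP_restricted S n ops \<longleftrightarrow>
     (\<forall>a b. wf_form S a \<and> wf_form S b \<and> valid_le n ops a b
        \<and> vars a \<subseteq> {..<n * n + n} \<and> vars b \<subseteq> {..<n * n} \<union> {n * n + n..<n * n + 2 * n} \<longrightarrow>
        (\<exists>i. wf_form S i \<and> vars i \<subseteq> {..<n * n} \<and> valid_le n ops a i \<and> valid_le n ops i b))"

section \<open>Order theory of a finite L-lattice\<close>

locale L_lattice =
  fixes S :: signature and n :: nat and ops :: "nat \<Rightarrow> nat list \<Rightarrow> nat"
  assumes wf_sig: "wf_sig S" and L_lattice: "is_L_lattice S n ops"
begin

abbreviation join (infixl "\<squnion>" 65) where "x \<squnion> y \<equiv> ljoin ops x y"
abbreviation meet (infixl "\<sqinter>" 70) where "x \<sqinter> y \<equiv> lmeet ops x y"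
abbreviation le (infix "\<sqsubseteq>" 50) where "x \<sqsubseteq> y \<equiv> lle ops x y"

lemma n_pos: "0 < n"
  using L_lattice by (simp add: is_L_lattice_def)

lemma connectives:
  "0 < length S" "1 < length S" "2 < length S"
  "fst (S ! 0) = 2" "fst (S ! 1) = 2" "fst (S ! 2) = 2"
  using wf_sig by (auto simp: wf_sig_def)

lemmas L_lattice_conjs = L_lattice[unfolded is_L_lattice_def, THEN conjunct2]

lemma ops_closed:
  "c < length S \<Longrightarrow> length xs = fst (S ! c) \<Longrightarrow> set xs \<subseteq> {..<n} \<Longrightarrow> ops c xs < n"
  by (rule L_lattice_conjs[THEN conjunct1, rule_format]) auto

lemma join_closed: "x < n \<Longrightarrow> y < n \<Longrightarrow> x \<squnion> y < n"
  unfolding ljoin_def by (rule ops_closed) (use connectives in auto)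

lemma meet_closed: "x < n \<Longrightarrow> y < n \<Longrightarrow> x \<sqinter> y < n"
  unfolding lmeet_def by (rule ops_closed) (use connectives in auto)

lemma lattice_axioms:
  "x < n \<Longrightarrow> y < n \<Longrightarrow> x \<squnion> y = y \<squnion> x"
  "x < n \<Longrightarrow> y < n \<Longrightarrow> x \<sqinter> y = y \<sqinter> x"
  "x < n \<Longrightarrow> y < n \<Longrightarrow> z < n \<Longrightarrow> (x \<squnion> y) \<squnion> z = x \<squnion> (y \<squnion> z)"
  "x < n \<Longrightarrow> y < n \<Longrightarrow> z < n \<Longrightarrow> (x \<sqinter> y) \<sqinter> z = x \<sqinter> (y \<sqinter> z)"
  "x < n \<Longrightarrow> y < n \<Longrightarrow> x \<squnion> (x \<sqinter> y) = x"
  "x < n \<Longrightarrow> y < n \<Longrightarrow> x \<sqinter> (x \<squnion> y) = x"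
  using L_lattice_conjs[THEN conjunct2, THEN conjunct1]
    L_lattice_conjs[THEN conjunct2, THEN conjunct2, THEN conjunct1]
    L_lattice_conjs[THEN conjunct2, THEN conjunct2, THEN conjunct2, THEN conjunct1]
  by blast+

lemma imp_eq_top:
  "t < n \<Longrightarrow> (\<And>x. x < n \<Longrightarrow> x \<sqsubseteq> t) \<Longrightarrow> a < n \<Longrightarrow> b < n \<Longrightarrow> t \<sqsubseteq> limp ops a b \<longleftrightarrow> a \<sqsubseteq> b"
  using L_lattice_conjs[THEN conjunct2, THEN conjunct2, THEN conjunct2, THEN conjunct2, THEN conjunct2]
  by blast

lemma le_refl: "x < n \<Longrightarrow> x \<sqsubseteq> x"
  unfolding lle_def by (metis lattice_axioms(5,6) meet_closed)

lemma le_trans: "x < n \<Longrightarrow> y < n \<Longrightarrow> z < n \<Longrightarrow> x \<sqsubseteq> y \<Longrightarrow> y \<sqsubseteq> z \<Longrightarrow> x \<sqsubseteq> z"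
  unfolding lle_def by (metis lattice_axioms(4))

lemma meet_le:
  assumes "x < n" "y < n" shows "x \<sqinter> y \<sqsubseteq> x" "x \<sqinter> y \<sqsubseteq> y"
proof -
  have "x \<sqinter> x = x" "y \<sqinter> y = y" using le_refl assms by (auto simp: lle_def)
  then show "x \<sqinter> y \<sqsubseteq> x" "x \<sqinter> y \<sqsubseteq> y"
    unfolding lle_def using assms by (metis lattice_axioms(2,4))+
qed

lemma le_meet: "x < n \<Longrightarrow> y < n \<Longrightarrow> z < n \<Longrightarrow> z \<sqsubseteq> x \<Longrightarrow> z \<sqsubseteq> y \<Longrightarrow> z \<sqsubseteq> x \<sqinter> y"
  unfolding lle_def by (metis lattice_axioms(4))

lemma le_iff_join: "x < n \<Longrightarrow> y < n \<Longrightarrow> x \<sqsubseteq> y \<longleftrightarrow> x \<squnion> y = y"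
  unfolding lle_def by (metis lattice_axioms(1,2,5,6))

lemma le_join:
  assumes "x < n" "y < n" shows "x \<sqsubseteq> x \<squnion> y" "y \<sqsubseteq> x \<squnion> y"
  unfolding lle_def using assms by (metis lattice_axioms(1,6))+

lemma join_le: "x < n \<Longrightarrow> y < n \<Longrightarrow> z < n \<Longrightarrow> x \<sqsubseteq> z \<Longrightarrow> y \<sqsubseteq> z \<Longrightarrow> x \<squnion> y \<sqsubseteq> z"
  by (metis le_iff_join lattice_axioms(3) join_closed)

lemma meet_le_if: "x < n \<Longrightarrow> y < n \<Longrightarrow> z < n \<Longrightarrow> x \<sqsubseteq> z \<or> y \<sqsubseteq> z \<Longrightarrow> x \<sqinter> y \<sqsubseteq> z"
  using meet_le[of x y] meet_closed[of x y] le_trans[of "x \<sqinter> y"] by blast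

lemma le_join_if: "x < n \<Longrightarrow> y < n \<Longrightarrow> z < n \<Longrightarrow> z \<sqsubseteq> x \<or> z \<sqsubseteq> y \<Longrightarrow> z \<sqsubseteq> x \<squnion> y"
  using le_join[of x y] join_closed[of x y] le_trans[of z _ "x \<squnion> y"] by blast

text \<open>The axiom for implication only speaks about top elements, so one has to be produced;
  joins are accumulated along initial segments of the carrier.\<close>

lemma top_exists: "\<exists>t<n. \<forall>x<n. x \<sqsubseteq> t"
proof -
  have "\<exists>t<n. \<forall>x<Suc k. x \<sqsubseteq> t" if "k < n" for k
    using that
  proof (induction k)
    case 0
    then show ?case using le_refl n_pos by auto
  next
    case (Suc k)
    then obtain t where t: "t < n" "\<And>x. x < Suc k \<Longrightarrow> x \<sqsubseteq> t" by auto
    have "x \<sqsubseteq> t \<squnion> Suc k" if "x < Suc (Suc k)" for x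
    proof (cases "x = Suc k")
      case True
      then show ?thesis using le_join t Suc.prems by simp
    next
      case False
      then have "x \<sqsubseteq> t" "x < n" using that t(2) Suc.prems by auto
      then show ?thesis
        using le_trans[of x t "t \<squnion> Suc k"] le_join[of t "Suc k"] join_closed t(1) Suc.prems by blast
    qed
    then show ?case using join_closed t(1) Suc.prems by blast
  qed
  from this[of "n - 1"] show ?thesis using n_pos by simp
qed

lemma feval_closed: "wf_form S a \<Longrightarrow> (\<And>x. v x < n) \<Longrightarrow> feval ops v a < n"
  by (induction a) (auto intro!: ops_closed)

text \<open>The right-hand formula has the top value under every valuation, so the inequality is
  valid; its two sides share no variable, which makes the interpolant closed.\<close>

lemma has_IP_imp_nullary:
  assumes "has_IP S n ops"
  shows "\<exists>c<length S. fst (S ! c) = 0"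
proof -
  let ?a = "\<lambda>x. Op 2 [Var x, Var x]"
  obtain t where t: "t < n" "\<And>x. x < n \<Longrightarrow> x \<sqsubseteq> t" using top_exists by blast
  have wf: "wf_form S (?a x)" for x using connectives by simp
  have "feval ops v (?a 0) \<sqsubseteq> feval ops v (?a 1)" if "\<forall>x. v x < n" for v
  proof -
    have "t \<sqsubseteq> feval ops v (?a 1)"
      using imp_eq_top[OF t, of "v 1" "v 1"] le_refl that by (simp add: limp_def)
    moreover have "feval ops v (?a 0) < n" "feval ops v (?a 1) < n"
      using wf feval_closed that by blast+
    ultimately show ?thesis using le_trans t by blast
  qed
  then have "valid_le n ops (?a 0) (?a 1)" by (simp add: valid_le_def)
  then obtain i where "wf_form S i" "vars i \<subseteq> vars (?a 0) \<inter> vars (?a 1)"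
    using assms wf unfolding has_IP_def by blast
  then show ?thesis using closed_form_imp_nullary[of S i] by auto
qed

text \<open>The left and the right block are disjoint, so shared variables can only lie below
  \<open>n * n\<close>.\<close>

lemma has_IP_imp_restricted: "has_IP S n ops \<Longrightarrow> IP_restricted S n ops"
  unfolding has_IP_def IP_restricted_def
proof (intro allI impI, elim conjE)
  fix a b
  assume *: "\<forall>a b. wf_form S a \<and> wf_form S b \<and> valid_le n ops a b \<longrightarrow>
      (\<exists>i. wf_form S i \<and> vars i \<subseteq> vars a \<inter> vars b \<and> valid_le n ops a i \<and> valid_le n ops i b)"
    and ab: "wf_form S a" "wf_form S b" "valid_le n ops a b"
    and va: "vars a \<subseteq> {..<n * n + n}"
    and vb: "vars b \<subseteq> {..<n * n} \<union> {n * n + n..<n * n + 2 * n}"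
  have "vars a \<inter> vars b \<subseteq> {..<n * n}" using va vb by fastforce
  then show "\<exists>i. wf_form S i \<and> vars i \<subseteq> {..<n * n} \<and> valid_le n ops a i \<and> valid_le n ops i b"
    using * ab by (meson subset_trans)
qed

text \<open>A left variable u is replaced by one that records v u, a right variable by one
  that records v' u, and an intersection variable by one that records the pair of both.\<close>

lemma restricted_imp_two_point_interpolant:
  assumes restr: "IP_restricted S n ops" and c: "c < length S" "fst (S ! c) = 0"
    and wf: "wf_form S a" "wf_form S b" and valid: "valid_le n ops a b"
    and v: "\<And>x. v x < n" and v': "\<And>x. v' x < n"
  shows "\<exists>i. wf_form S i \<and> vars i \<subseteq> vars a \<inter> vars b
    \<and> feval ops v a \<sqsubseteq> feval ops v i \<and> feval ops v' i \<sqsubseteq> feval ops v' b"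
proof -
  let ?Y = "vars a \<inter> vars b"
  let ?pair = "\<lambda>u. v u * n + v' u"
  define s where "s u = (if u \<in> ?Y then Var (?pair u)
    else if u \<in> vars a then Var (n * n + v u) else Var (n * n + n + v' u))" for u
  \<comment> \<open>\<open>r\<close> leads back to the original variables: an index that codes an
    occurring pair goes to one chosen variable with that pair, any other index to the nullary
    constant, so no foreign variable enters.\<close>
  define r where "r j = (if \<exists>u\<in>?Y. ?pair u = j then Var (SOME u. u \<in> ?Y \<and> ?pair u = j)
    else Op c [])" for j
  have pair_less: "?pair u < n * n" for u
  proof -
    have "Suc (v u) * n \<le> n * n" using v[of u] by (intro mult_le_mono) auto
    then show ?thesis using v'[of u] by simp
  qed
  have pair_inj: "v u = v w" "v' u = v' w" if "?pair u = ?pair w" for u w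
  proof -
    have "?pair u div n = v u" "?pair u mod n = v' u" "?pair w div n = v w" "?pair w mod n = v' w"
      using v'[of u] v'[of w] by auto
    then show "v u = v w" "v' u = v' w" using that by simp_all
  qed
  \<comment> \<open>The chosen representative may differ from \<open>u\<close>, but \<open>v\<close>
    and \<open>v'\<close> cannot tell the two apart.\<close>
  have r_Y: "\<exists>w\<in>?Y. r (?pair u) = Var w \<and> v w = v u \<and> v' w = v' u" if "u \<in> ?Y" for u
  proof -
    define w where "w = (SOME w. w \<in> ?Y \<and> ?pair w = ?pair u)"
    have "w \<in> ?Y \<and> ?pair w = ?pair u"
      unfolding w_def by (rule someI[of _ u]) (use that in simp)
    then show ?thesis using that pair_inj[of w u] by (auto simp: r_def w_def)
  qed
  have wf_r: "wf_form S (r j)" for j using c by (simp add: r_def)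
  have vars_r: "vars (r j) \<subseteq> ?Y" for j
  proof (cases "\<exists>u\<in>?Y. ?pair u = j")
    case True
    then have "(SOME u. u \<in> ?Y \<and> ?pair u = j) \<in> ?Y"
      by (metis (mono_tags, lifting) someI_ex)
    then show ?thesis using True by (simp add: r_def)
  qed (auto simp: r_def)
  have wf_s: "wf_form S (s u)" for u by (simp add: s_def)
  have valid_s: "valid_le n ops (subst s a) (subst s b)"
    using valid wf_s unfolding valid_le_def feval_subst by (simp add: feval_closed)
  have "vars (s u) \<subseteq> {..<n * n + n}" if "u \<in> vars a" for u
    using that pair_less[of u] v[of u] by (auto simp: s_def)
  then have vars_sa: "vars (subst s a) \<subseteq> {..<n * n + n}"
    unfolding vars_subst by blast
  have "vars (s u) \<subseteq> {..<n * n} \<union> {n * n + n..<n * n + 2 * n}" if "u \<in> vars b" for u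
    using that pair_less[of u] v'[of u] by (auto simp: s_def)
  then have vars_sb: "vars (subst s b) \<subseteq> {..<n * n} \<union> {n * n + n..<n * n + 2 * n}"
    unfolding vars_subst by blast
  have "\<exists>i. wf_form S i \<and> vars i \<subseteq> {..<n * n}
      \<and> valid_le n ops (subst s a) i \<and> valid_le n ops i (subst s b)"
    by (rule restr[unfolded IP_restricted_def, rule_format])
      (intro conjI wf_subst wf wf_s valid_s vars_sa vars_sb)
  then obtain i where i: "wf_form S i" "vars i \<subseteq> {..<n * n}"
      "valid_le n ops (subst s a) i" "valid_le n ops i (subst s b)"
    by (elim exE conjE)
  \<comment> \<open>\<open>e\<close> and \<open>e'\<close> transport \<open>v\<close> and
    \<open>v'\<close> to the restricted variables. Below \<open>n * n\<close> they are defined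
    through \<open>r\<close>, so that evaluating \<open>i\<close> becomes evaluating
    \<open>subst r i\<close>; on its own block each decodes the recorded value, and 0 elsewhere
    keeps it in the carrier.\<close>
  define e where "e j = (if j < n * n then feval ops v (r j)
    else if j < n * n + n then j - n * n else 0)" for j
  define e' where "e' j = (if j < n * n then feval ops v' (r j)
    else if n * n + n \<le> j \<and> j < n * n + 2 * n then j - (n * n + n) else 0)" for j
  have e: "e j < n" and e': "e' j < n" for j
    using n_pos wf_r v v' feval_closed by (auto simp: e_def e'_def)
  have "feval ops e (s u) = v u" if "u \<in> vars a" for u
  proof (cases "u \<in> ?Y")
    case True
    then show ?thesis using r_Y[OF True] pair_less[of u] by (auto simp: s_def e_def)
  next
    case False
    then show ?thesis using that v[of u] by (auto simp: s_def e_def)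
  qed
  then have "feval ops e (subst s a) = feval ops v a"
    unfolding feval_subst by (rule feval_cong)
  moreover have "feval ops e' (s u) = v' u" if "u \<in> vars b" for u
  proof (cases "u \<in> ?Y")
    case True
    then show ?thesis using r_Y[OF True] pair_less[of u] by (auto simp: s_def e'_def)
  next
    case False
    then show ?thesis using that v'[of u] by (auto simp: s_def e'_def)
  qed
  then have "feval ops e' (subst s b) = feval ops v' b"
    unfolding feval_subst by (rule feval_cong)
  moreover have "feval ops e i = feval ops v (subst r i)" "feval ops e' i = feval ops v' (subst r i)"
    unfolding feval_subst using i(2) by (auto intro!: feval_cong simp: e_def e'_def)
  moreover have "feval ops e (subst s a) \<sqsubseteq> feval ops e i" "feval ops e' i \<sqsubseteq> feval ops e' (subst s b)"
    using i(3,4) e e' unfolding valid_le_def by blast+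
  moreover have "wf_form S (subst r i)" using i(1) wf_r by (rule wf_subst)
  moreover have "vars (subst r i) \<subseteq> ?Y" using vars_r unfolding vars_subst by blast
  ultimately show ?thesis by metis
qed

lemma restricted_imp_has_IP:
  assumes restr: "IP_restricted S n ops" and c: "c < length S" "fst (S ! c) = 0"
  shows "has_IP S n ops"
  unfolding has_IP_def
proof (intro allI impI, elim conjE)
  fix a b
  assume wf: "wf_form S a" "wf_form S b" and valid: "valid_le n ops a b"
  define I where "I = {i. wf_form S i \<and> vars i \<subseteq> vars a \<inter> vars b}"
  let ?W = "vars a \<union> vars b"
  \<comment> \<open>Fixing the value 0 off the variables of \<open>a\<close> and \<open>b\<close>
    makes the set of valuations finite, so that the meets and joins over it are formulas.\<close>
  define V where "V = {v. \<forall>x. (x \<in> ?W \<longrightarrow> v x \<in> {..<n}) \<and> (x \<notin> ?W \<longrightarrow> v x = 0)}"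
  have finV: "finite V" unfolding V_def by (intro finite_set_of_finite_funs) (auto simp: finite_vars)
  have V: "v x < n" if "v \<in> V" for v x
    using that n_pos by (cases "x \<in> ?W") (auto simp: V_def)
  have meet_I: "Op 1 [i, j] \<in> I" and join_I: "Op 0 [i, j] \<in> I" if "i \<in> I" "j \<in> I" for i j
    using that connectives by (auto simp: I_def)
  \<comment> \<open>For fixed \<open>v\<close> this is the meet over \<open>F\<close>. The empty
    meet is replaced by a two-point interpolant for \<open>v\<close> and \<open>v\<close>, which has
    the required lower bound at \<open>v\<close>.\<close>
  have lower: "\<exists>i\<in>I. feval ops v a \<sqsubseteq> feval ops v i \<and> (\<forall>v'\<in>F. feval ops v' i \<sqsubseteq> feval ops v' b)"
    if "finite F" "F \<subseteq> V" "v \<in> V" for v F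
    using that
  proof (induction F rule: finite_induct)
    case empty
    then show ?case
      using restricted_imp_two_point_interpolant[OF restr c wf valid, of v v] V unfolding I_def by blast
  next
    case (insert v' F)
    obtain i where i: "i \<in> I" "feval ops v a \<sqsubseteq> feval ops v i"
        "\<forall>v'\<in>F. feval ops v' i \<sqsubseteq> feval ops v' b"
      using insert.IH insert.prems by auto
    obtain j where j: "j \<in> I" "feval ops v a \<sqsubseteq> feval ops v j" "feval ops v' j \<sqsubseteq> feval ops v' b"
      using restricted_imp_two_point_interpolant[OF restr c wf valid, of v v'] V insert.prems unfolding I_def by blast
    have closed: "feval ops w i < n" "feval ops w j < n" "feval ops w a < n" "feval ops w b < n"
      if "w \<in> V" for w
      using i(1) j(1) wf V[OF that] by (auto simp: I_def intro: feval_closed)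
    have eq: "feval ops w (Op 1 [i, j]) = feval ops w i \<sqinter> feval ops w j" for w
      by (simp add: lmeet_def)
    have "feval ops v a \<sqsubseteq> feval ops v (Op 1 [i, j])"
      unfolding eq using i(2) j(2) closed insert.prems by (intro le_meet) auto
    moreover have "feval ops w (Op 1 [i, j]) \<sqsubseteq> feval ops w b" if w: "w \<in> insert v' F" for w
    proof -
      have wV: "w \<in> V" using w insert.prems by blast
      have "feval ops w i \<sqsubseteq> feval ops w b \<or> feval ops w j \<sqsubseteq> feval ops w b"
        using w i(3) j(3) by blast
      then show ?thesis
        unfolding eq using closed[OF wV] by (intro meet_le_if)
    qed
    ultimately show ?case using meet_I[OF i(1) j(1)] by blast
  qed
  \<comment> \<open>Dually, the join over \<open>F\<close>. In place of the empty join any formula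
    below \<open>b\<close> on \<open>V\<close> will do; \<open>lower\<close> at the zero valuation
    provides one.\<close>
  have "\<exists>i\<in>I. (\<forall>v\<in>F. feval ops v a \<sqsubseteq> feval ops v i) \<and> (\<forall>v'\<in>V. feval ops v' i \<sqsubseteq> feval ops v' b)"
    if "finite F" "F \<subseteq> V" for F
    using that
  proof (induction F rule: finite_induct)
    case empty
    have "(\<lambda>_. 0) \<in> V" using n_pos by (simp add: V_def)
    then show ?case using lower[OF finV order_refl] by blast
  next
    case (insert v F)
    obtain i where i: "i \<in> I" "\<forall>v\<in>F. feval ops v a \<sqsubseteq> feval ops v i"
        "\<forall>v'\<in>V. feval ops v' i \<sqsubseteq> feval ops v' b"
      using insert.IH insert.prems by auto
    obtain j where j: "j \<in> I" "feval ops v a \<sqsubseteq> feval ops v j"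
        "\<forall>v'\<in>V. feval ops v' j \<sqsubseteq> feval ops v' b"
      using lower[OF finV order_refl] insert.prems by blast
    have closed: "feval ops w i < n" "feval ops w j < n" "feval ops w a < n" "feval ops w b < n"
      if "w \<in> V" for w
      using i(1) j(1) wf V[OF that] by (auto simp: I_def intro: feval_closed)
    have eq: "feval ops w (Op 0 [i, j]) = feval ops w i \<squnion> feval ops w j" for w
      by (simp add: ljoin_def)
    have "feval ops w (Op 0 [i, j]) \<sqsubseteq> feval ops w b" if w: "w \<in> V" for w
      unfolding eq using i(3) j(3) closed w by (intro join_le) auto
    moreover have "feval ops w a \<sqsubseteq> feval ops w (Op 0 [i, j])" if w: "w \<in> insert v F" for w
    proof -
      have wV: "w \<in> V" using w insert.prems by blast
      have "feval ops w a \<sqsubseteq> feval ops w i \<or> feval ops w a \<sqsubseteq> feval ops w j"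
        using w i(2) j(2) by blast
      then show ?thesis
        unfolding eq using closed[OF wV] by (intro le_join_if)
    qed
    ultimately show ?case using join_I[OF i(1) j(1)] by blast
  qed
  from this[OF finV order_refl] obtain i where i: "i \<in> I"
      "\<forall>v\<in>V. feval ops v a \<sqsubseteq> feval ops v i" "\<forall>v\<in>V. feval ops v i \<sqsubseteq> feval ops v b"
    by blast
  \<comment> \<open>An arbitrary valuation is moved into \<open>V\<close> by resetting it to 0 off
    \<open>?W\<close>, which changes none of the three values.\<close>
  have "feval ops v a \<sqsubseteq> feval ops v i \<and> feval ops v i \<sqsubseteq> feval ops v b" if "\<forall>x. v x < n" for v
  proof -
    let ?w = "\<lambda>x. if x \<in> ?W then v x else 0"
    have "?w \<in> V" using that by (simp add: V_def)
    moreover have "feval ops ?w a = feval ops v a" "feval ops ?w b = feval ops v b"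
        "feval ops ?w i = feval ops v i"
      using i(1) by (auto simp: I_def intro!: feval_cong)
    ultimately show ?thesis using i(2,3) by metis
  qed
  then show "\<exists>i. wf_form S i \<and> vars i \<subseteq> vars a \<inter> vars b \<and> valid_le n ops a i \<and> valid_le n ops i b"
    using i(1) unfolding valid_le_def I_def by blast
qed

lemma has_IP_iff:
  "has_IP S n ops \<longleftrightarrow> (\<exists>c<length S. fst (S ! c) = 0) \<and> IP_restricted S n ops"
  using has_IP_imp_nullary has_IP_imp_restricted restricted_imp_has_IP by blast

end

section \<open>Tables as numbers\<close>

text \<open>One digit function codes every finite object used below: valuations and tables in base
  \<open>n\<close>, sets of tables in base 2, tuples of tables in base
  \<open>ntables x\<close>.\<close>

definition dig :: "nat \<Rightarrow> nat \<Rightarrow> nat \<Rightarrow> nat" where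
  "dig b t p = t div b ^ p mod b"

lemma dig_less: "0 < b \<Longrightarrow> dig b t p < b"
  by (simp add: dig_def)

lemma dig_add_high:
  assumes "0 < b" "p < m" shows "dig b (t + a * b ^ m) p = dig b t p"
proof -
  obtain d where m: "m = p + Suc d" using less_imp_Suc_add[OF assms(2)] by auto
  \<comment> \<open>Since \<open>p < m\<close>, the added term is still a multiple of
    \<open>b\<close> after division by \<open>b ^ p\<close> and so vanishes modulo
    \<open>b\<close>.\<close>
  have "t + a * b ^ m = t + (a * b ^ d * b) * b ^ p"
    by (simp add: m power_add algebra_simps)
  also have "\<dots> div b ^ p = a * b ^ d * b + t div b ^ p"
    using assms(1) by (intro div_mult_self1) simp
  finally show ?thesis by (simp add: dig_def)
qed

lemma dig_mod: "0 < b \<Longrightarrow> p < m \<Longrightarrow> dig b (t mod b ^ m) p = dig b t p"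
  using dig_add_high[of b p m "t mod b ^ m" "t div b ^ m"] unfolding mod_div_mult_eq by simp

text \<open>This is what turns a quantifier over functions from \<open>{..<m}\<close> to
  \<open>{..<b}\<close> into a bounded quantifier over numbers.\<close>

lemma number_with_digits:
  assumes "0 < b" "\<And>p. p < m \<Longrightarrow> f p < b"
  shows "\<exists>t<b ^ m. \<forall>p<m. dig b t p = f p"
  using assms(2)
proof (induction m)
  case (Suc m)
  then obtain t where t: "t < b ^ m" "\<forall>p<m. dig b t p = f p" by auto
  let ?t = "t + f m * b ^ m"
  have "Suc (f m) * b ^ m \<le> b * b ^ m" using Suc.prems[of m] by (intro mult_le_mono) auto
  then have "?t < b ^ Suc m" using t(1) by simp
  moreover have "dig b ?t p = f p" if "p < Suc m" for p
  proof (cases "p = m")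
    case True
    then show ?thesis using t(1) Suc.prems[of m] assms(1) by (simp add: dig_def)
  next
    case False
    then show ?thesis using that t(2) dig_add_high[OF assms(1)] by simp
  qed
  ultimately show ?case by blast
qed simp

lemma concat_blocks:
  assumes "length T = l"
  shows "length (concat (map (\<lambda>x. map (g x) T) [0..<m])) = m * l"
    and "w < m * l \<Longrightarrow> concat (map (\<lambda>x. map (g x) T) [0..<m]) ! w = g (w div l) (T ! (w mod l))"
proof -
  show len: "length (concat (map (\<lambda>x. map (g x) T) [0..<m])) = m * l" for m
    using assms by (induction m) auto
  show "w < m * l \<Longrightarrow> concat (map (\<lambda>x. map (g x) T) [0..<m]) ! w = g (w div l) (T ! (w mod l))"
  proof (induction m)
    case (Suc m)
    show ?case
    proof (cases "w < m * l")
      case True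
      then show ?thesis using Suc.IH len[of m] by (simp add: nth_append)
    next
      case False
      then have w: "w - m * l < l" "w = (w - m * l) + m * l" using Suc.prems by auto
      then have "w div l = m" "w mod l = w - m * l"
        by (metis add.commute add_diff_cancel_left' div_mult_self1 div_less less_nat_zero_code
            add_0 mult.commute not_gr_zero)
          (metis w mod_less mod_mult_self1)
      then show ?thesis using False len[of m] assms w by (simp add: nth_append)
    qed
  qed simp
qed

lemma length_tuples: "length (tuples n k) = n ^ k"
  by (induction k) (simp_all add: concat_blocks)

text \<open>The recursion of \<open>tuples\<close> lets the first coordinate vary slowest, so it is
  the most significant digit of the position; this explains the reversed index
  \<open>k - 1 - j\<close>.\<close>

lemma nth_tuples:
  "w < n ^ k \<Longrightarrow> tuples n k ! w = map (\<lambda>j. dig n w (k - 1 - j)) [0..<k]"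
proof (induction k arbitrary: w)
  case (Suc k)
  then have n: "0 < n" by (cases n) auto
  have less: "w mod n ^ k < n ^ k" using n by simp
  have "tuples n (Suc k) ! w = (w div n ^ k) # tuples n k ! (w mod n ^ k)"
    using Suc.prems by (simp add: concat_blocks length_tuples)
  also have "tuples n k ! (w mod n ^ k) = map (\<lambda>j. dig n w (k - 1 - j)) [0..<k]"
    unfolding Suc.IH[OF less] using n by (auto simp: dig_mod)
  also have "w div n ^ k = dig n w k"
    using Suc.prems by (simp add: dig_def less_mult_imp_div_less)
  finally show ?case
    by (simp add: upt_conv_Cons map_Suc_upt[symmetric] comp_def del: upt_Suc)
qed simp

section \<open>The decision procedure\<close>

definition nconn :: "nat \<Rightarrow> nat" where "nconn x = elen (enth x 0)"
definition arity :: "nat \<Rightarrow> nat \<Rightarrow> nat" where "arity x c = efst (enth (enth x 0) c)"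
definition lsize :: "nat \<Rightarrow> nat" where "lsize x = enth x 1"
definition opval :: "nat \<Rightarrow> nat \<Rightarrow> nat \<Rightarrow> nat" where
  "opval x c w = enth (enth (enth x 2) c) w"
text \<open>The variables are the \<open>n * n\<close> intersection ones and \<open>n\<close> on
  either side; a point is a valuation of them, and a table an arbitrary function from points to the
  carrier.\<close>

definition nvars :: "nat \<Rightarrow> nat" where "nvars x = lsize x * lsize x + 2 * lsize x"
definition npoints :: "nat \<Rightarrow> nat" where "npoints x = lsize x ^ nvars x"
definition ntables :: "nat \<Rightarrow> nat" where "ntables x = lsize x ^ npoints x"

text \<open>A set of tables is the number C whose binary digits are its characteristic function.
  A number z codes, by its digits in base ntables x, a tuple of arguments; the lexicographic
  enumeration of tuples makes the position w of a row big-endian.\<close>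

definition op_closed :: "nat \<Rightarrow> nat \<Rightarrow> bool" where
  "op_closed x C \<longleftrightarrow> (\<forall>c<nconn x. \<forall>z<ntables x ^ arity x c.
     (\<forall>j<arity x c. dig 2 C (dig (ntables x) z j) = 1) \<longrightarrow>
     (\<forall>t<ntables x.
       (\<forall>p<npoints x. \<forall>w<lsize x ^ arity x c.
         (\<forall>j<arity x c. dig (lsize x) w (arity x c - 1 - j) = dig (lsize x) (dig (ntables x) z j) p)
         \<longrightarrow> dig (lsize x) t p = opval x c w)
       \<longrightarrow> dig 2 C t = 1))"

text \<open>A point \<open>p\<close> is read as the valuation whose value at variable
  \<open>j\<close> is digit \<open>j\<close> of \<open>p\<close>.\<close>

definition is_projection :: "nat \<Rightarrow> nat \<Rightarrow> nat \<Rightarrow> bool" where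
  "is_projection x t j \<longleftrightarrow> (\<forall>p<npoints x. dig (lsize x) t p = dig (lsize x) p j)"

text \<open>The term functions in the variables below m and those from h on, as the least closed set.\<close>

definition generated :: "nat \<Rightarrow> nat \<Rightarrow> nat \<Rightarrow> nat \<Rightarrow> bool" where
  "generated x m h t \<longleftrightarrow> (\<forall>C<2 ^ ntables x.
     op_closed x C \<and>
     (\<forall>j<nvars x. j < m \<or> h \<le> j \<longrightarrow> (\<forall>s<ntables x. is_projection x s j \<longrightarrow> dig 2 C s = 1))
     \<longrightarrow> dig 2 C t = 1)"

text \<open>Connective 1 is the meet, and its row lists the pair of \<open>y\<close> and
  \<open>z\<close> at position \<open>y * lsize x + z\<close>; the equation is the order expressed
  by meets.\<close>

definition table_le :: "nat \<Rightarrow> nat \<Rightarrow> nat \<Rightarrow> bool" where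
  "table_le x s t \<longleftrightarrow> (\<forall>p<npoints x.
     opval x 1 (dig (lsize x) s p * lsize x + dig (lsize x) t p) = dig (lsize x) s p)"

text \<open>The thresholds given to \<open>generated\<close> select the blocks: intersection and
  left variables for \<open>s\<close>, intersection and right ones for \<open>t\<close>,
  intersection variables alone for \<open>r\<close>.\<close>

definition decision :: "nat \<Rightarrow> bool" where
  "decision x \<longleftrightarrow> (\<exists>c<nconn x. arity x c = 0) \<and>
    (\<forall>s<ntables x. \<forall>t<ntables x.
      generated x (lsize x * lsize x + lsize x) (nvars x) s
      \<and> generated x (lsize x * lsize x) (lsize x * lsize x + lsize x) t
      \<and> table_le x s t \<longrightarrow>
      (\<exists>r<ntables x. generated x (lsize x * lsize x) (nvars x) r \<and> table_le x s r \<and> table_le x r t))"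

section \<open>Computability of the decision procedure\<close>

lemma computable_comp3:
  assumes "computable (\<lambda>e. F (e 0) (e 1) (e 2))" "computable f" "computable g" "computable h"
  shows "computable (\<lambda>e. F (f e) (g e) (h e))"
  using computable_substitution[OF assms(1), of "\<lambda>i. if i = 0 then f else if i = 1 then g else h"]
    assms(2-) by simp

lemma computable_comp4:
  assumes "computable (\<lambda>e. F (e 0) (e 1) (e 2) (e 3))"
    and "computable f" "computable g" "computable h" "computable k"
  shows "computable (\<lambda>e. F (f e) (g e) (h e) (k e))"
  using computable_substitution[OF assms(1),
      of "\<lambda>i. if i = 0 then f else if i = 1 then g else if i = 2 then h else k"]
    assms(2-) by simp

lemma computable_dig:
  "computable f \<Longrightarrow> computable g \<Longrightarrow> computable h \<Longrightarrow> computable (\<lambda>e. dig (f e) (g e) (h e))"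
  unfolding dig_def by (intro computable_intros)

lemma computable_sizes:
  assumes "computable f"
  shows "computable (\<lambda>e. nconn (f e))" "computable (\<lambda>e. lsize (f e))" "computable (\<lambda>e. nvars (f e))"
    "computable (\<lambda>e. npoints (f e))" "computable (\<lambda>e. ntables (f e))"
  unfolding nconn_def lsize_def nvars_def npoints_def ntables_def
  by (intro computable_intros computable_elen computable_enth assms)+

lemma computable_arity: "computable f \<Longrightarrow> computable g \<Longrightarrow> computable (\<lambda>e. arity (f e) (g e))"
  unfolding arity_def by (intro computable_intros computable_efst computable_enth)

lemma computable_opval:
  "computable f \<Longrightarrow> computable g \<Longrightarrow> computable h \<Longrightarrow> computable (\<lambda>e. opval (f e) (g e) (h e))"
  unfolding opval_def by (intro computable_intros computable_enth)

lemmas computable_intros' = computable_intros computable_dig computable_sizes computable_arity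
  computable_opval

lemma decidable_op_closed:
  "computable f \<Longrightarrow> computable g \<Longrightarrow> decidable (\<lambda>e. op_closed (f e) (g e))"
  by (rule computable_comp2[where F = "\<lambda>x C. of_bool (op_closed x C)"], unfold op_closed_def)
    (intro computable_intros' | assumption)+

lemma decidable_is_projection:
  "computable f \<Longrightarrow> computable g \<Longrightarrow> computable h \<Longrightarrow> decidable (\<lambda>e. is_projection (f e) (g e) (h e))"
  by (rule computable_comp3[where F = "\<lambda>x t j. of_bool (is_projection x t j)"], unfold is_projection_def)
    (intro computable_intros' | assumption)+

lemma decidable_generated:
  "computable f \<Longrightarrow> computable g \<Longrightarrow> computable h \<Longrightarrow> computable k \<Longrightarrow>
    decidable (\<lambda>e. generated (f e) (g e) (h e) (k e))"
  by (rule computable_comp4[where F = "\<lambda>x m h t. of_bool (generated x m h t)"], unfold generated_def)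
    (intro computable_intros' decidable_op_closed decidable_is_projection | assumption)+

lemma decidable_table_le:
  "computable f \<Longrightarrow> computable g \<Longrightarrow> computable h \<Longrightarrow> decidable (\<lambda>e. table_le (f e) (g e) (h e))"
  by (rule computable_comp3[where F = "\<lambda>x s t. of_bool (table_le x s t)"], unfold table_le_def)
    (intro computable_intros' | assumption)+

lemma decidable_decision: "decidable (\<lambda>e. decision (e 0))"
  unfolding decision_def by (intro computable_intros' decidable_generated decidable_table_le)

lemma rec_eval_decision: "\<exists>f. \<forall>x. rec_eval f [x] (of_bool (decision x))"
proof -
  obtain k r where r: "\<And>e. rec_eval r (map e [0..<k]) (of_bool (decision (e 0)))"
    using decidable_decision unfolding computable_def by blast
  \<comment> \<open>The program expects \<open>k\<close> entries; each of them is fed the single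
    input, which is harmless because \<open>decision\<close> depends on entry 0 alone.\<close>
  have "rec_eval (Comp r (replicate k (Proj 0))) [x] (of_bool (decision x))" for x
  proof (rule rec_eval.comp)
    show "rec_eval r (map (\<lambda>_. x) [0..<k]) (of_bool (decision x))"
      using r[of "\<lambda>_. x"] .
    show "list_all2 (\<lambda>g. rec_eval g [x]) (replicate k (Proj 0)) (map (\<lambda>_. x) [0..<k])"
      using rec_eval.proj[of 0 "[x]"] by (auto simp: list_all2_conv_all_nth)
  qed
  then show ?thesis by blast
qed

section \<open>Correctness on the encoding of a lattice\<close>

context L_lattice
begin

abbreviation "X \<equiv> encode_input S n ops"

lemma nconn_X: "nconn X = length S"
  by (simp add: nconn_def encode_input_def enth_list_encode elen_list_encode del: list_encode.simps)

lemma lsize_X: "lsize X = n"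
  by (simp add: lsize_def encode_input_def enth_list_encode del: list_encode.simps)

lemma arity_X: "c < length S \<Longrightarrow> arity X c = fst (S ! c)"
  by (simp add: arity_def encode_input_def enth_list_encode encode_conn_def efst_def
      del: list_encode.simps)

lemma opval_X:
  assumes "c < length S" "w < n ^ fst (S ! c)"
    and "\<And>j. j < fst (S ! c) \<Longrightarrow> dig n w (fst (S ! c) - 1 - j) = xs ! j"
    and "length xs = fst (S ! c)"
  shows "opval X c w = ops c xs"
proof -
  have "opval X c w = ops c (tuples n (fst (S ! c)) ! w)"
    using assms(1,2)
    by (simp add: opval_def encode_input_def enth_list_encode length_tuples del: list_encode.simps)
  also have "tuples n (fst (S ! c)) ! w = xs"
    unfolding nth_tuples[OF assms(2)] by (rule nth_equalityI) (use assms(3,4) in auto)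
  finally show ?thesis .
qed

abbreviation "K \<equiv> n * n + 2 * n"
abbreviation "N \<equiv> n ^ K"
abbreviation "Q \<equiv> n ^ N"

lemma sizes_X: "nvars X = K" "npoints X = N" "ntables X = Q"
  by (simp_all add: nvars_def npoints_def ntables_def lsize_X)

lemma Q_pos: "0 < Q"
  using n_pos by simp

text \<open>\<open>dig n p\<close> is total with values in the carrier, so it serves directly as the
  valuation coded by \<open>p\<close>.\<close>

definition is_table :: "form \<Rightarrow> nat \<Rightarrow> bool" where
  "is_table a t \<longleftrightarrow> t < Q \<and> (\<forall>p<N. dig n t p = feval ops (dig n p) a)"

lemma feval_dig: "wf_form S a \<Longrightarrow> feval ops (dig n p) a < n"
  using n_pos by (intro feval_closed dig_less)

lemma table_exists: "wf_form S a \<Longrightarrow> \<exists>t. is_table a t"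
  unfolding is_table_def
  using number_with_digits[OF n_pos, where m = N and f = "\<lambda>p. feval ops (dig n p) a"] feval_dig
  by blast

text \<open>Every valuation agrees on the first \<open>K\<close> variables with
  \<open>dig n p\<close> for some \<open>p < N\<close>, so comparing the formulas at the points
  amounts to validity.\<close>

lemma table_le_X:
  assumes "is_table a s" "is_table b t" "wf_form S a" "wf_form S b"
    and vars: "vars a \<subseteq> {..<K}" "vars b \<subseteq> {..<K}"
  shows "table_le X s t \<longleftrightarrow> valid_le n ops a b"
proof -
  have op: "opval X 1 (x * n + y) = x \<sqinter> y" if "x < n" "y < n" for x y
  proof -
    have "Suc x * n \<le> n * n" using that by (intro mult_le_mono) auto
    then have "x * n + y < n ^ 2" using that by (simp add: power2_eq_square)
    moreover have "dig n (x * n + y) (2 - 1 - j) = [x, y] ! j" if "j < 2" for j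
      using that \<open>x < n\<close> \<open>y < n\<close> by (auto simp: less_2_cases_iff dig_def)
    ultimately show ?thesis
      unfolding lmeet_def using connectives by (intro opval_X) auto
  qed
  have "table_le X s t \<longleftrightarrow> (\<forall>p<N. feval ops (dig n p) a \<sqsubseteq> feval ops (dig n p) b)"
    using assms(1,2) op feval_dig[OF assms(3)] feval_dig[OF assms(4)]
    by (simp add: table_le_def is_table_def lsize_X sizes_X lle_def)
  also have "\<dots> \<longleftrightarrow> valid_le n ops a b"
    unfolding valid_le_def
  proof (intro iffI allI impI)
    fix v :: "nat \<Rightarrow> nat" assume *: "\<forall>p<N. feval ops (dig n p) a \<sqsubseteq> feval ops (dig n p) b" and "\<forall>x. v x < n"
    then obtain p where p: "p < N" "\<And>j. j < K \<Longrightarrow> dig n p j = v j"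
      using number_with_digits[OF n_pos, of K v] by blast
    have "feval ops (dig n p) a = feval ops v a" "feval ops (dig n p) b = feval ops v b"
      using vars p(2) by (auto intro!: feval_cong)
    then show "feval ops v a \<sqsubseteq> feval ops v b" using * p(1) by metis
  qed (auto simp: dig_less n_pos)
  finally show ?thesis .
qed

lemma is_projection_X: "t < Q \<Longrightarrow> is_projection X t j \<longleftrightarrow> is_table (Var j) t"
  by (simp add: is_projection_def is_table_def lsize_X sizes_X)

text \<open>At each point some row position \<open>w\<close> matches the argument values, and every
  match gives the same entry; the guarded quantifier over \<open>w\<close> is therefore a table
  lookup.\<close>

lemma op_row_X:
  assumes c: "c < length S" and as: "length as = fst (S ! c)" "\<forall>a\<in>set as. wf_form S a"
    and z: "\<And>j. j < fst (S ! c) \<Longrightarrow> is_table (as ! j) (dig Q z j)"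
    and t: "t < Q"
  shows "(\<forall>p<npoints X. \<forall>w<lsize X ^ arity X c.
      (\<forall>j<arity X c. dig (lsize X) w (arity X c - 1 - j) = dig (lsize X) (dig (ntables X) z j) p)
      \<longrightarrow> dig (lsize X) t p = opval X c w) \<longleftrightarrow> is_table (Op c as) t"
proof -
  let ?k = "fst (S ! c)"
  have row: "(\<forall>w<n ^ ?k. (\<forall>j<?k. dig n w (?k - 1 - j) = dig n (dig Q z j) p) \<longrightarrow> dig n t p = opval X c w)
      \<longleftrightarrow> dig n t p = feval ops (dig n p) (Op c as)" if p: "p < N" for p
  proof -
    let ?xs = "map (feval ops (dig n p)) as"
    have xs: "?xs ! j = dig n (dig Q z j) p" if "j < ?k" for j
      using z[OF that] p that as(1) by (simp add: is_table_def)
    have op: "opval X c w = ops c ?xs"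
      if "w < n ^ ?k" "\<forall>j<?k. dig n w (?k - 1 - j) = dig n (dig Q z j) p" for w
      using that xs as(1) by (intro opval_X[OF c]) auto
    \<comment> \<open>The reversed index converts the argument list into the little-endian digits of
      its row position.\<close>
    obtain w where w: "w < n ^ ?k" "\<forall>i<?k. dig n w i = ?xs ! (?k - 1 - i)"
      using number_with_digits[OF n_pos, of ?k "\<lambda>i. ?xs ! (?k - 1 - i)"] feval_dig as by fastforce
    have "\<forall>j<?k. dig n w (?k - 1 - j) = dig n (dig Q z j) p"
      using w(2) xs by auto
    then show ?thesis using op w(1) by auto
  qed
  then show ?thesis using t by (simp add: is_table_def lsize_X sizes_X arity_X[OF c] del: feval.simps)
qed

text \<open>Structural induction: closure under the operations passes membership from the tables of
  the arguments to the table of the compound formula. This is the half of \<open>generated_X\<close>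
  saying that term functions lie in every admissible set.\<close>

lemma bit_of_term_table:
  assumes closed: "op_closed X C"
    and proj: "\<And>j s. j \<in> J \<Longrightarrow> s < Q \<Longrightarrow> is_projection X s j \<Longrightarrow> dig 2 C s = 1"
  shows "wf_form S a \<Longrightarrow> vars a \<subseteq> J \<Longrightarrow> is_table a t \<Longrightarrow> dig 2 C t = 1"
proof (induction a arbitrary: t)
  case (Var j)
  then show ?case using proj[of j t] is_projection_X[of t j] by (simp add: is_table_def)
next
  case (Op c as)
  have c: "c < length S" and as: "length as = fst (S ! c)" "\<forall>a\<in>set as. wf_form S a"
    using Op.prems(1) by auto
  obtain T where T: "\<And>a. a \<in> set as \<Longrightarrow> is_table a (T a)"
    using table_exists as(2) by metis
  then have TQ: "T (as ! j) < Q" if "j < fst (S ! c)" for j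
    using that as(1) by (auto simp: is_table_def)
  \<comment> \<open>The argument tables are packed as digits of one number, the form in which
    \<open>op_closed\<close> quantifies over tuples.\<close>
  obtain z where z: "z < Q ^ fst (S ! c)" "\<forall>j<fst (S ! c). dig Q z j = T (as ! j)"
    using number_with_digits[OF Q_pos, of "fst (S ! c)" "\<lambda>j. T (as ! j)"] TQ by blast
  have z': "is_table (as ! j) (dig Q z j)" if "j < fst (S ! c)" for j
    using that z(2) T as(1) by simp
  have "dig 2 C (dig Q z j) = 1" if "j < fst (S ! c)" for j
    using Op.IH[OF _ _ _ z'[OF that]] Op.prems as that by (auto simp: SUP_le_iff)
  moreover have t: "t < Q" using Op.prems(3) by (simp add: is_table_def)
  ultimately show ?case
    using closed[unfolded op_closed_def, rule_format, of c z t] c z(1)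
      op_row_X[OF c as z' t] Op.prems(3)
    by (simp add: nconn_X sizes_X arity_X)
qed

text \<open>For the forward direction \<open>C\<close> is taken to be the set of all tables of
  formulas over \<open>J\<close>. It contains the projections and is closed, since formulas chosen
  for the argument tables combine under the connective.\<close>

lemma generated_X:
  assumes t: "t < Q" and J: "J = {j. j < K \<and> (j < m \<or> h \<le> j)}"
  shows "generated X m h t \<longleftrightarrow> (\<exists>a. wf_form S a \<and> vars a \<subseteq> J \<and> is_table a t)"
proof
  let ?P = "\<lambda>t. \<exists>a. wf_form S a \<and> vars a \<subseteq> J \<and> is_table a t"
  assume gen: "generated X m h t"
  have "of_bool (?P t) < (2 :: nat)" for t by (cases "?P t") auto
  then obtain C where C: "C < 2 ^ Q" "\<And>t. t < Q \<Longrightarrow> dig 2 C t = of_bool (?P t)"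
    using number_with_digits[of 2 Q "\<lambda>t. of_bool (?P t)"] by (metis zero_less_numeral)
  have "op_closed X C"
    unfolding op_closed_def nconn_X
  proof (intro allI impI)
    fix c z t
    assume c: "c < length S" and t: "t < ntables X"
      and bits: "\<forall>j<arity X c. dig 2 C (dig (ntables X) z j) = 1"
      and row: "\<forall>p<npoints X. \<forall>w<lsize X ^ arity X c.
        (\<forall>j<arity X c. dig (lsize X) w (arity X c - 1 - j) = dig (lsize X) (dig (ntables X) z j) p)
        \<longrightarrow> dig (lsize X) t p = opval X c w"
    have "?P (dig Q z j)" if "j < fst (S ! c)" for j
    proof -
      have "dig 2 C (dig Q z j) = 1" using bits that c by (simp add: sizes_X arity_X)
      then show ?thesis
        using C(2)[OF dig_less[OF Q_pos, of z j]] by (cases "?P (dig Q z j)") simp_all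
    qed
    then obtain f where f: "\<And>j. j < fst (S ! c) \<Longrightarrow>
        wf_form S (f j) \<and> vars (f j) \<subseteq> J \<and> is_table (f j) (dig Q z j)"
      by metis
    let ?as = "map f [0..<fst (S ! c)]"
    have "is_table (Op c ?as) t"
      using row t f by (subst op_row_X[OF c, symmetric]) (auto simp: sizes_X)
    moreover have "wf_form S (Op c ?as)" "vars (Op c ?as) \<subseteq> J" using c f by (auto simp: subset_iff)
    ultimately have "?P t" by blast
    then show "dig 2 C t = 1" using C(2)[of t] t by (simp add: sizes_X)
  qed
  moreover have "dig 2 C s = 1"
    if "j < nvars X" "j < m \<or> h \<le> j" "s < ntables X" "is_projection X s j" for j s
  proof -
    have "is_table (Var j) s" using that is_projection_X by (simp add: sizes_X)
    moreover have "wf_form S (Var j)" "vars (Var j) \<subseteq> J" using that J by (auto simp: sizes_X)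
    ultimately have "?P s" by blast
    then show ?thesis using C(2)[of s] that by (simp add: sizes_X)
  qed
  ultimately have "dig 2 C t = 1"
    using gen C(1) unfolding generated_def by (simp add: sizes_X)
  then show "?P t" using C(2)[OF t] by (cases "?P t") simp_all
next
  assume "\<exists>a. wf_form S a \<and> vars a \<subseteq> J \<and> is_table a t"
  then obtain a where a: "wf_form S a" "vars a \<subseteq> J" "is_table a t" by blast
  show "generated X m h t"
    unfolding generated_def
  proof (intro allI impI, elim conjE)
    fix C
    assume "op_closed X C" and
      "\<forall>j<nvars X. j < m \<or> h \<le> j \<longrightarrow> (\<forall>s<ntables X. is_projection X s j \<longrightarrow> dig 2 C s = 1)"
    then show "dig 2 C t = 1"
      by (intro bit_of_term_table[OF _ _ a]) (auto simp: sizes_X J)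
  qed
qed

text \<open>By \<open>generated_X\<close> the quantifiers over generated tables range over the
  formulas in the respective block, and by \<open>table_le_X\<close> table comparison is validity.
  This gives \<open>IP_restricted\<close>, and \<open>has_IP_iff\<close> adds the nullary
  connective.\<close>

lemma decision_X: "decision X \<longleftrightarrow> has_IP S n ops"
proof -
  let ?A = "{..<n * n + n}" and ?B = "{..<n * n} \<union> {n * n + n..<K}" and ?I = "{..<n * n}"
  have gen:
    "s < Q \<Longrightarrow> generated X (n * n + n) K s \<longleftrightarrow> (\<exists>a. wf_form S a \<and> vars a \<subseteq> ?A \<and> is_table a s)"
    "s < Q \<Longrightarrow> generated X (n * n) (n * n + n) s \<longleftrightarrow> (\<exists>a. wf_form S a \<and> vars a \<subseteq> ?B \<and> is_table a s)"
    "s < Q \<Longrightarrow> generated X (n * n) K s \<longleftrightarrow> (\<exists>a. wf_form S a \<and> vars a \<subseteq> ?I \<and> is_table a s)"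
    for s
    by (rule generated_X; force)+
  have sub: "?A \<subseteq> {..<K}" "?B \<subseteq> {..<K}" "?I \<subseteq> {..<K}" by auto
  have le_iff: "table_le X s t \<longleftrightarrow> valid_le n ops a b"
    if "is_table a s" "is_table b t" "wf_form S a" "wf_form S b" "vars a \<subseteq> V" "vars b \<subseteq> W"
      "V \<subseteq> {..<K}" "W \<subseteq> {..<K}" for a b s t V W
    using table_le_X that by (meson subset_trans)
  let ?D = "\<forall>s<Q. \<forall>t<Q. generated X (n * n + n) K s \<and> generated X (n * n) (n * n + n) t
      \<and> table_le X s t \<longrightarrow> (\<exists>r<Q. generated X (n * n) K r \<and> table_le X s r \<and> table_le X r t)"
  have "?D \<longleftrightarrow> IP_restricted S n ops"
  proof
    assume D: ?D
    show "IP_restricted S n ops"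
      unfolding IP_restricted_def
    proof (intro allI impI, elim conjE)
      fix a b
      assume wf: "wf_form S a" "wf_form S b" and valid: "valid_le n ops a b"
        and va: "vars a \<subseteq> ?A" and vb: "vars b \<subseteq> ?B"
      obtain s t where s: "is_table a s" and t: "is_table b t" using table_exists wf by blast
      have "s < Q" "t < Q" using s t by (auto simp: is_table_def)
      moreover have "table_le X s t" using le_iff[OF s t wf va vb sub(1,2)] valid by simp
      moreover have "generated X (n * n + n) K s" using gen(1)[OF \<open>s < Q\<close>] wf va s by blast
      moreover have "generated X (n * n) (n * n + n) t" using gen(2)[OF \<open>t < Q\<close>] wf vb t by blast
      ultimately obtain r where r: "r < Q" "generated X (n * n) K r" "table_le X s r" "table_le X r t"
        using D by blast
      obtain i where i: "wf_form S i" "vars i \<subseteq> ?I" "is_table i r"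
        using r(2) unfolding gen(3)[OF r(1)] by blast
      have "valid_le n ops a i"
        using le_iff[OF s i(3) wf(1) i(1) va i(2) sub(1,3)] r(3) by simp
      moreover have "valid_le n ops i b"
        using le_iff[OF i(3) t i(1) wf(2) i(2) vb sub(3,2)] r(4) by simp
      ultimately show "\<exists>i. wf_form S i \<and> vars i \<subseteq> ?I \<and> valid_le n ops a i \<and> valid_le n ops i b"
        using i(1,2) by (intro exI[of _ i] conjI)
    qed
  next
    assume R: "IP_restricted S n ops"
    show ?D
    proof (intro allI impI, elim conjE)
      fix s t
      assume st: "s < Q" "t < Q" and le: "table_le X s t"
        and "generated X (n * n + n) K s" "generated X (n * n) (n * n + n) t"
      then obtain a b where a: "wf_form S a" "vars a \<subseteq> ?A" "is_table a s"
          and b: "wf_form S b" "vars b \<subseteq> ?B" "is_table b t"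
        unfolding gen(1)[OF st(1)] gen(2)[OF st(2)] by (elim exE conjE)
      have "valid_le n ops a b"
        using le_iff[OF a(3) b(3) a(1) b(1) a(2) b(2) sub(1,2)] le by simp
      then have "\<exists>i. wf_form S i \<and> vars i \<subseteq> ?I \<and> valid_le n ops a i \<and> valid_le n ops i b"
        by (intro R[unfolded IP_restricted_def, rule_format] conjI a b)
      then obtain i where i: "wf_form S i" "vars i \<subseteq> ?I" "valid_le n ops a i" "valid_le n ops i b"
        by (elim exE conjE)
      obtain r where r: "is_table i r" using table_exists i(1) by blast
      then have "r < Q" by (simp add: is_table_def)
      moreover have "generated X (n * n) K r" using gen(3)[OF \<open>r < Q\<close>] i(1,2) r by blast
      moreover have "table_le X s r"
        using le_iff[OF a(3) r a(1) i(1) a(2) i(2) sub(1,3)] i(3) by simp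
      moreover have "table_le X r t"
        using le_iff[OF r b(3) i(1) b(1) i(2) b(2) sub(3,2)] i(4) by simp
      ultimately show "\<exists>r<Q. generated X (n * n) K r \<and> table_le X s r \<and> table_le X r t" by blast
    qed
  qed
  then show ?thesis
    unfolding decision_def has_IP_iff nconn_X lsize_X sizes_X using arity_X by auto
qed

end

theorem mainTheorem9:
  shows "\<exists>f. \<forall>S n ops. wf_sig S \<and> is_L_lattice S n ops \<longrightarrow>
           rec_eval f [encode_input S n ops] (if has_IP S n ops then 1 else 0)"
proof -
  obtain f where f: "\<And>x. rec_eval f [x] (of_bool (decision x))"
    using rec_eval_decision by blast
  have "rec_eval f [encode_input S n ops] (if has_IP S n ops then 1 else 0)"
    if "wf_sig S" "is_L_lattice S n ops" for S n ops
  proof -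
    interpret L_lattice S n ops by (rule L_lattice.intro) fact+
    show ?thesis using f[of "encode_input S n ops"] unfolding decision_X of_bool_def .
  qed
  then show ?thesis by blast
qed

end
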